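(* Let $G$ be a finite group, $X$ a finite $G$-set, $H$ a subgroup of $G$, $A$ a finite set with $|A|\ge2$, $a\in A$, $A'=A\setminus\{a\}$, and $N_c=\{0,1\}$. Then \[\varphi_{H,t}(J_{N_c,A,a}(X))=\prod_{i=1}^{\infty}(1+|A'|t^i)^{O_{X,H,i}},\] and in particular $\varphi_H(J_{N_c,A,a}(X))=|A|^{O_H(X)}$, where $O_{X,H,i}$ is the number of $H$-orbits of $X$ of cardinality $i$ and $O_H(X)$ is the number of $H$-orbits of $X$.
   Context: $A'^{[1]}$ is the set of maps $\{1\}\to A'$ (degree 1) and $A'^{[0]}=\{a\}$ (degree 0). $J_{N_c,A,a}(X)$ is the set of maps $f:X\to A'^{[0]}\sqcup A'^{[1]}$ with $G$-action $(gf)(x)=f(g^{-1}x)$; $\deg f=\sum_x\deg f(x)$ and $J^n_{N_c,A,a}(X)=\{f:\deg f=n\}$. For a finite $G$-set $Z$, $\varphi_H(Z)$ is the number of points of $Z$ fixed by all of $H$, and $\varphi_{H,t}(J_{N_c,A,a}(X))=\sum_{n\ge0}\varphi_H(J^n_{N_c,A,a}(X))t^n$. *)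

theory Defs
  imports
    "HOL-Algebra.Group_Action"
    "HOL-Computational_Algebra.Formal_Power_Series"
    "HOL-Analysis.Infinite_Products"
begin

text \<open>With \<open>A' = A - {a}\<close>, the left summand \<open>{a}\<close> is \<open>A'\<^sup>[\<^sup>0\<^sup>]\<close> and the right
  summand, the maps \<open>{1} \<rightarrow> A'\<close>, is \<open>A'\<^sup>[\<^sup>1\<^sup>]\<close>; the tag determines the degree. Maps on \<open>X\<close>
  are extensional, so that each is counted once.\<close>

definition J_set :: "'a set \<Rightarrow> 'a \<Rightarrow> 'x set \<Rightarrow> ('x \<Rightarrow> 'a + (nat \<Rightarrow> 'a)) set" where
  "J_set A a X = X \<rightarrow>\<^sub>E ({a} <+> ({1} \<rightarrow>\<^sub>E (A - {a})))"

definition word_deg :: "'a + (nat \<Rightarrow> 'a) \<Rightarrow> nat" where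
  "word_deg w = (case w of Inl _ \<Rightarrow> 0 | Inr _ \<Rightarrow> 1)"

definition J_deg :: "'x set \<Rightarrow> ('x \<Rightarrow> 'a + (nat \<Rightarrow> 'a)) \<Rightarrow> nat" where
  "J_deg X f = (\<Sum>x\<in>X. word_deg (f x))"

definition J_grade :: "'a set \<Rightarrow> 'a \<Rightarrow> 'x set \<Rightarrow> nat \<Rightarrow> ('x \<Rightarrow> 'a + (nat \<Rightarrow> 'a)) set" where
  "J_grade A a X n = {f \<in> J_set A a X. J_deg X f = n}"

definition J_act :: "('g, 'm) monoid_scheme \<Rightarrow> 'x set \<Rightarrow> ('g \<Rightarrow> 'x \<Rightarrow> 'x)
    \<Rightarrow> 'g \<Rightarrow> ('x \<Rightarrow> 'b) \<Rightarrow> ('x \<Rightarrow> 'b)" where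
  "J_act G X \<phi> g f = (\<lambda>x\<in>X. f (\<phi> (inv\<^bsub>G\<^esub> g) x))"

definition num_fixed :: "'g set \<Rightarrow> ('g \<Rightarrow> 'z \<Rightarrow> 'z) \<Rightarrow> 'z set \<Rightarrow> nat" where
  "num_fixed H \<psi> Z = card {z \<in> Z. \<forall>h\<in>H. \<psi> h z = z}"

definition J_fixed_series :: "('g, 'm) monoid_scheme \<Rightarrow> 'x set \<Rightarrow> ('g \<Rightarrow> 'x \<Rightarrow> 'x)
    \<Rightarrow> 'g set \<Rightarrow> 'a set \<Rightarrow> 'a \<Rightarrow> int fps" where
  "J_fixed_series G X \<phi> H A a =
     Abs_fps (\<lambda>n. int (num_fixed H (J_act G X \<phi>) (J_grade A a X n)))"

definition sub_orbits :: "('g, 'm) monoid_scheme \<Rightarrow> 'g set \<Rightarrow> 'x set \<Rightarrow> ('g \<Rightarrow> 'x \<Rightarrow> 'x)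
    \<Rightarrow> 'x set set" where
  "sub_orbits G H X \<phi> = orbits (G\<lparr>carrier := H\<rparr>) X \<phi>"

definition num_orbits :: "('g, 'm) monoid_scheme \<Rightarrow> 'g set \<Rightarrow> 'x set \<Rightarrow> ('g \<Rightarrow> 'x \<Rightarrow> 'x) \<Rightarrow> nat" where
  "num_orbits G H X \<phi> = card (sub_orbits G H X \<phi>)"

definition num_orbits_card :: "('g, 'm) monoid_scheme \<Rightarrow> 'g set \<Rightarrow> 'x set \<Rightarrow> ('g \<Rightarrow> 'x \<Rightarrow> 'x)
    \<Rightarrow> nat \<Rightarrow> nat" where
  "num_orbits_card G H X \<phi> i = card {B \<in> sub_orbits G H X \<phi>. card B = i}"

text \<open>Under \<open>J_act\<close>, \<open>J_set\<close> and \<open>J_grade\<close> are finite \<open>G\<close>-sets.\<close>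

lemma finite_J_set:
  assumes "finite X" "finite A"
  shows "finite (J_set A a X)"
  using assms unfolding J_set_def by (intro finite_PiE finite_Plus) auto

context group_action
begin

lemma J_act_closed:
  assumes g: "g \<in> carrier G" and f: "f \<in> J_grade A a E n"
  shows "J_act G E \<phi> g f \<in> J_grade A a E n"
proof -
  interpret group_hom G "BijGroup E" \<phi> by (rule group_hom)
  have ig: "inv g \<in> carrier G" using g by simp
  have bij: "bij_betw (\<phi> (inv g)) E E"
    using bij_prop0[OF ig] by (simp add: Bij_def)
  have mem: "\<phi> (inv g) x \<in> E" if "x \<in> E" for x
    using bij that by (auto simp: bij_betw_def)
  have "(\<Sum>x\<in>E. word_deg (f (\<phi> (inv g) x))) = (\<Sum>x\<in>E. word_deg (f x))"
    by (rule sum.reindex_bij_betw[OF bij])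
  then have "J_deg E (J_act G E \<phi> g f) = J_deg E f"
    unfolding J_deg_def J_act_def by simp
  moreover have "J_act G E \<phi> g f \<in> J_set A a E"
    using f mem unfolding J_act_def J_grade_def J_set_def by (auto simp: PiE_iff)
  ultimately show ?thesis using f by (simp add: J_grade_def)
qed

lemma group_action_J_aux:
  assumes cl: "\<And>g f. g \<in> carrier G \<Longrightarrow> f \<in> Z \<Longrightarrow> J_act G E \<phi> g f \<in> Z"
    and ext: "Z \<subseteq> extensional E"
  shows "group_action G Z (\<lambda>g. restrict (J_act G E \<phi> g) Z)"
proof -
  interpret group_hom G "BijGroup E" \<phi> by (rule group_hom)
  have mem: "\<phi> (inv g) x \<in> E" if "x \<in> E" "g \<in> carrier G" for x g
    using element_image[of "inv g" x] that by simp
  have comp: "J_act G E \<phi> g (J_act G E \<phi> h f) = J_act G E \<phi> (g \<otimes> h) f"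
    if g: "g \<in> carrier G" and h: "h \<in> carrier G" for g h f
  proof
    fix x
    show "J_act G E \<phi> g (J_act G E \<phi> h f) x = J_act G E \<phi> (g \<otimes> h) f x"
    proof (cases "x \<in> E")
      case True
      have "\<phi> (inv (g \<otimes> h)) x = \<phi> (inv h) (\<phi> (inv g) x)"
        using composition_rule[OF True, of "inv h" "inv g"] g h by (simp add: G.inv_mult_group)
      then show ?thesis using True mem g unfolding J_act_def by simp
    qed (simp add: J_act_def)
  qed
  have one: "J_act G E \<phi> \<one> f = f" if "f \<in> Z" for f
  proof
    fix x
    have "f \<in> extensional E" using that ext by auto
    moreover have "\<phi> (inv \<one>) x = x" if "x \<in> E"
      using fun_cong[OF id_eq_one, of x] that by (simp del: hom_one)
    ultimately show "J_act G E \<phi> \<one> f x = f x"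
      by (simp add: J_act_def restrict_def extensional_def del: hom_one G.inv_one)
  qed
  have bij: "restrict (J_act G E \<phi> g) Z \<in> Bij Z" if g: "g \<in> carrier G" for g
  proof -
    have "bij_betw (J_act G E \<phi> g) Z Z"
      by (rule bij_betw_byWitness[where f' = "J_act G E \<phi> (inv g)"])
         (use g in \<open>auto simp: cl comp one\<close>)
    then show ?thesis by (simp add: Bij_def cong: bij_betw_cong)
  qed
  show ?thesis
    unfolding group_action_def group_hom_def group_hom_axioms_def
  proof (intro conjI)
    show "(\<lambda>g. restrict (J_act G E \<phi> g) Z) \<in> hom G (BijGroup Z)"
    proof (rule homI)
      fix g assume "g \<in> carrier G"
      then show "restrict (J_act G E \<phi> g) Z \<in> carrier (BijGroup Z)"
        using bij by (simp add: BijGroup_def)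
    next
      fix g h assume g: "g \<in> carrier G" and h: "h \<in> carrier G"
      have "restrict (J_act G E \<phi> (g \<otimes> h)) Z
          = compose Z (restrict (J_act G E \<phi> g) Z) (restrict (J_act G E \<phi> h) Z)"
        using g h cl by (auto simp: fun_eq_iff compose_def comp restrict_def)
      then show "restrict (J_act G E \<phi> (g \<otimes> h)) Z
          = restrict (J_act G E \<phi> g) Z \<otimes>\<^bsub>BijGroup Z\<^esub> restrict (J_act G E \<phi> h) Z"
        using bij g h by (simp add: BijGroup_def)
    qed
  qed (simp_all add: group_BijGroup)
qed

lemma group_action_J_grade:
  "group_action G (J_grade A a E n) (\<lambda>g. restrict (J_act G E \<phi> g) (J_grade A a E n))"
  by (rule group_action_J_aux[OF J_act_closed])
     (auto simp: J_grade_def J_set_def PiE_iff)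

lemma group_action_J_set:
  "group_action G (J_set A a E) (\<lambda>g. restrict (J_act G E \<phi> g) (J_set A a E))"
proof (rule group_action_J_aux)
  fix g f assume "g \<in> carrier G" "f \<in> J_set A a E"
  then have "J_act G E \<phi> g f \<in> J_grade A a E (J_deg E f)"
    by (intro J_act_closed) (simp_all add: J_grade_def)
  then show "J_act G E \<phi> g f \<in> J_set A a E" by (simp add: J_grade_def)
qed (auto simp: J_set_def PiE_iff)

end

end

theory Submission
  imports Defs
begin

text \<open>A map on \<open>X\<close> is fixed by \<open>H\<close> iff it is constant on the \<open>H\<close>-orbits, so a fixed map is a
  free choice of a letter for each orbit, and a nonzero letter on an orbit of size \<open>k\<close>
  contributes degree \<open>k\<close>. Summing \<open>t ^ deg f\<close> over the fixed maps thus gives the product over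
  the orbits \<open>B\<close> of \<open>1 + |A'| t ^ card B\<close>, in any commutative semiring; \<open>t = fps_X\<close> gives the
  series and \<open>t = 1\<close> the number of fixed maps.\<close>

definition block_constant :: "'x set set \<Rightarrow> ('x \<Rightarrow> 'v) \<Rightarrow> bool" where
  "block_constant P f \<longleftrightarrow> (\<forall>B\<in>P. \<forall>x\<in>B. \<forall>y\<in>B. f x = f y)"

lemma partition_on_the_block:
  assumes "partition_on X P" and "B \<in> P" and "x \<in> B"
  shows "(THE B. B \<in> P \<and> x \<in> B) = B"
  using assms(2,3) partition_onD2[OF assms(1)]
  by (intro the_equality) (auto simp: pairwise_def disjnt_iff)

text \<open>A block-constant map factors uniquely through the quotient map from \<open>X\<close> to
  \<open>P\<close>, which sends \<open>x\<close> to the only block containing it. Nothing here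
  involves a group, so the counting is kept apart from the action.\<close>

lemma bij_betw_block_constant:
  assumes P: "partition_on X P"
  shows "bij_betw (\<lambda>g. \<lambda>x\<in>X. g (THE B. B \<in> P \<and> x \<in> B)) (P \<rightarrow>\<^sub>E V)
           {f \<in> X \<rightarrow>\<^sub>E V. block_constant P f}"
proof -
  define block where "block x = (THE B. B \<in> P \<and> x \<in> B)" for x
  \<comment> \<open>The inverse reads off the value of \<open>f\<close> at one point of each block.
    Any choice of points works, since \<open>f\<close> is constant on blocks.\<close>
  define rep where "rep B = (SOME x. x \<in> B)" for B :: "'a set"
  have block_eq: "block x = B" if "B \<in> P" "x \<in> B" for x B
    unfolding block_def by (rule partition_on_the_block[OF P that])
  have ne: "rep B \<in> B" if "B \<in> P" for B
    using that partition_onD3[OF P] unfolding rep_def by (metis some_in_eq)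
  have block_rep: "block (rep B) = B" if "B \<in> P" for B
    using block_eq[OF that ne[OF that]] .
  have block_mem: "block x \<in> P" "x \<in> block x" if x: "x \<in> X" for x
  proof -
    obtain B where B: "B \<in> P" "x \<in> B"
      using x partition_onD1[OF P] by blast
    then show "block x \<in> P" "x \<in> block x"
      by (simp_all add: block_eq[OF B])
  qed
  have sub: "B \<subseteq> X" if "B \<in> P" for B
    using that partition_onD1[OF P] by blast
  have rep_mem: "rep B \<in> X" if "B \<in> P" for B
    using ne sub that by blast
  have "bij_betw (\<lambda>g. \<lambda>x\<in>X. g (block x)) (P \<rightarrow>\<^sub>E V) {f \<in> X \<rightarrow>\<^sub>E V. block_constant P f}"
  proof (rule bij_betw_byWitness[where f' = "\<lambda>f. \<lambda>B\<in>P. f (rep B)"])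
    show "\<forall>g\<in>P \<rightarrow>\<^sub>E V. (\<lambda>B\<in>P. (\<lambda>x\<in>X. g (block x)) (rep B)) = g"
    proof
      fix g assume g: "g \<in> P \<rightarrow>\<^sub>E V"
      show "(\<lambda>B\<in>P. (\<lambda>x\<in>X. g (block x)) (rep B)) = g"
        by (rule extensionalityI[of _ P]) (use g in \<open>auto simp: PiE_iff rep_mem block_rep\<close>)
    qed
    show "\<forall>f\<in>{f \<in> X \<rightarrow>\<^sub>E V. block_constant P f}. (\<lambda>x\<in>X. (\<lambda>B\<in>P. f (rep B)) (block x)) = f"
    proof
      fix f assume f: "f \<in> {f \<in> X \<rightarrow>\<^sub>E V. block_constant P f}"
      show "(\<lambda>x\<in>X. (\<lambda>B\<in>P. f (rep B)) (block x)) = f"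
      proof (rule extensionalityI[of _ X])
        fix x assume x: "x \<in> X"
        have "f (rep (block x)) = f x"
          using f block_mem[OF x] ne[OF block_mem(1)[OF x]] unfolding block_constant_def by blast
        then show "(\<lambda>x\<in>X. (\<lambda>B\<in>P. f (rep B)) (block x)) x = f x"
          using x by (simp add: block_mem(1))
      qed (use f in \<open>auto simp: PiE_iff\<close>)
    qed
    have "block_constant P (\<lambda>x\<in>X. g (block x))" for g :: "'a set \<Rightarrow> 'b"
      unfolding block_constant_def
    proof (intro ballI)
      fix B x y assume "B \<in> P" "x \<in> B" "y \<in> B"
      then show "(\<lambda>x\<in>X. g (block x)) x = (\<lambda>x\<in>X. g (block x)) y"
        using sub[of B] block_eq[of B x] block_eq[of B y] by (simp add: subset_iff)
    qed
    then show "(\<lambda>g. \<lambda>x\<in>X. g (block x)) ` (P \<rightarrow>\<^sub>E V) \<subseteq> {f \<in> X \<rightarrow>\<^sub>E V. block_constant P f}"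
      by (auto simp: PiE_iff block_mem(1))
    show "(\<lambda>f. \<lambda>B\<in>P. f (rep B)) ` {f \<in> X \<rightarrow>\<^sub>E V. block_constant P f} \<subseteq> P \<rightarrow>\<^sub>E V"
      by (auto simp: PiE_iff rep_mem)
  qed
  then show ?thesis by (simp add: block_def)
qed

text \<open>Rewritten as a sum over the choices \<open>g\<close> of one letter per block, the
  exponent splits into one term per block. The power becomes a product over blocks, and
  distributivity turns the sum over all \<open>g\<close> into a product of sums over
  \<open>V\<close>.\<close>

lemma sum_power_block_constant:
  fixes t :: "'c :: comm_semiring_1" and w :: "'v \<Rightarrow> nat"
  assumes "finite X" and P: "partition_on X P" and V: "finite V"
  shows "(\<Sum>f | f \<in> X \<rightarrow>\<^sub>E V \<and> block_constant P f. t ^ (\<Sum>x\<in>X. w (f x)))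
           = (\<Prod>B\<in>P. \<Sum>v\<in>V. t ^ (card B * w v))"
proof -
  have finP: "finite P" using finite_elements[OF assms(1) P] .
  have finB: "\<forall>B\<in>P. finite B"
    using assms(1) partition_onD1[OF P] by (metis Sup_upper finite_subset)
  define block where "block x = (THE B. B \<in> P \<and> x \<in> B)" for x
  have block_eq: "block x = B" if "B \<in> P" "x \<in> B" for x B
    unfolding block_def by (rule partition_on_the_block[OF P that])
  \<comment> \<open>Each of the \<open>card B\<close> points of a block \<open>B\<close> carries the
    same letter \<open>g B\<close>.\<close>
  have deg: "(\<Sum>x\<in>X. w ((\<lambda>x\<in>X. g (block x)) x)) = (\<Sum>B\<in>P. card B * w (g B))" for g
  proof -
    have "(\<Sum>x\<in>X. w ((\<lambda>x\<in>X. g (block x)) x)) = (\<Sum>x\<in>\<Union>P. w (g (block x)))"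
      using partition_onD1[OF P] by simp
    also have "\<dots> = (\<Sum>B\<in>P. \<Sum>x\<in>B. w (g (block x)))"
      using partition_onD2[OF P] finB
      by (subst sum.Union_disjoint) (auto simp: pairwise_def disjnt_def)
    also have "\<dots> = (\<Sum>B\<in>P. card B * w (g B))"
      by (intro sum.cong) (simp_all add: block_eq)
    finally show ?thesis .
  qed
  have "(\<Sum>f | f \<in> X \<rightarrow>\<^sub>E V \<and> block_constant P f. t ^ (\<Sum>x\<in>X. w (f x)))
      = (\<Sum>g\<in>P \<rightarrow>\<^sub>E V. t ^ (\<Sum>x\<in>X. w ((\<lambda>x\<in>X. g (block x)) x)))"
    using sum.reindex_bij_betw[OF bij_betw_block_constant[OF P, of V],
        of "\<lambda>f. t ^ (\<Sum>x\<in>X. w (f x))"]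
    unfolding block_def by simp
  also have "\<dots> = (\<Sum>g\<in>P \<rightarrow>\<^sub>E V. \<Prod>B\<in>P. t ^ (card B * w (g B)))"
    by (simp only: deg power_sum)
  also have "\<dots> = (\<Prod>B\<in>P. \<Sum>v\<in>V. t ^ (card B * w v))"
    using prod_sum_PiE[OF finP, of "\<lambda>_. V" "\<lambda>B v. t ^ (card B * w v)"] V by simp
  finally show ?thesis .
qed

text \<open>The only word of degree 0 gives the summand 1. The words of degree 1 correspond to the
  elements of \<open>A - {a}\<close>, and each gives \<open>t ^ k\<close>.\<close>

lemma sum_power_word_deg:
  fixes t :: "'c :: comm_semiring_1"
  assumes "finite A"
  shows "(\<Sum>v\<in>{a} <+> ({1} \<rightarrow>\<^sub>E A - {a}). t ^ (k * word_deg v))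
           = 1 + of_nat (card (A - {a})) * t ^ k"
  using assms by (simp add: sum.Plus word_deg_def finite_PiE card_PiE)

lemma (in group_action) partition_on_orbits: "partition_on E (orbits G E \<phi>)"
proof (rule partition_onI)
  show "\<Union> (orbits G E \<phi>) = E" by (rule orbits_coverture)
  show "disjnt B C" if "B \<in> orbits G E \<phi>" "C \<in> orbits G E \<phi>" "B \<noteq> C" for B C
    using disjoint_union[OF that(1,2)] that(3) by (auto simp: disjnt_def)
  show "{} \<notin> orbits G E \<phi>"
    using orbit_refl by (force simp: orbits_def)
qed

lemma (in group_action) partition_on_sub_orbits:
  assumes "subgroup H G"
  shows "partition_on E (sub_orbits G H E \<phi>)"
  unfolding sub_orbits_def
  by (rule group_action.partition_on_orbits[OF induced_action[OF assms]])

text \<open>Invariance under \<open>H\<close> means that moving a point by an element of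
  \<open>H\<close> keeps the value of \<open>f\<close>, and such moves sweep out exactly the orbits.
  Extensionality is what makes \<open>f\<close> agree with its translates outside \<open>E\<close>,
  where \<open>J_act\<close> is \<open>undefined\<close>.\<close>

lemma (in group_action) J_act_fixed_iff:
  assumes H: "subgroup H G" and f: "f \<in> extensional E"
  shows "(\<forall>h\<in>H. J_act G E \<phi> h f = f) \<longleftrightarrow> block_constant (sub_orbits G H E \<phi>) f"
proof -
  interpret group_hom G "BijGroup E" \<phi> by (rule group_hom)
  have HG: "h \<in> carrier G" if "h \<in> H" for h
    using subgroup.subset[OF H] that by auto
  have invH: "inv h \<in> H" if "h \<in> H" for h
    using subgroup.m_inv_closed[OF H that] .
  have inv_inv: "inv (inv h) = h" if "h \<in> H" for h
    using HG[OF that] by simp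
  have one: "\<phi> \<one> x = x" if "x \<in> E" for x
    using fun_cong[OF id_eq_one, of x] that by (simp del: hom_one)
  have "(\<forall>h\<in>H. J_act G E \<phi> h f = f) \<longleftrightarrow> (\<forall>h\<in>H. \<forall>x\<in>E. f (\<phi> (inv h) x) = f x)"
    using f unfolding J_act_def fun_eq_iff restrict_def extensional_def by auto
  also have "\<dots> \<longleftrightarrow> (\<forall>h\<in>H. \<forall>x\<in>E. f (\<phi> h x) = f x)"
    using invH inv_inv by metis
  also have "\<dots> \<longleftrightarrow> block_constant (sub_orbits G H E \<phi>) f"
  proof
    assume "\<forall>h\<in>H. \<forall>x\<in>E. f (\<phi> h x) = f x"
    then show "block_constant (sub_orbits G H E \<phi>) f"
      by (auto simp: block_constant_def sub_orbits_def orbits_def orbit_def)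
  next
    assume const: "block_constant (sub_orbits G H E \<phi>) f"
    show "\<forall>h\<in>H. \<forall>x\<in>E. f (\<phi> h x) = f x"
    proof (intro ballI)
      fix h x assume h: "h \<in> H" and x: "x \<in> E"
      let ?B = "orbit (G\<lparr>carrier := H\<rparr>) \<phi> x"
      have "?B \<in> sub_orbits G H E \<phi>"
        using x by (auto simp: sub_orbits_def orbits_def)
      moreover have "\<phi> h x \<in> ?B" using h by (auto simp: orbit_def)
      moreover have "x \<in> ?B"
        using subgroup.one_closed[OF H] one[OF x] by (force simp: orbit_def)
      ultimately show "f (\<phi> h x) = f x"
        using const unfolding block_constant_def by blast
    qed
  qed
  finally show ?thesis .
qed

text \<open>The weighted count for partitions, applied with the \<open>H\<close>-orbits as blocks,
  the words as letters and \<open>word_deg\<close> as weight.\<close>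

lemma (in group_action) sum_power_J_deg_fixed:
  fixes t :: "'d :: comm_semiring_1" and A :: "'e set"
  assumes "subgroup H G" and "finite E" and "finite A"
  shows "(\<Sum>f | f \<in> J_set A a E \<and> (\<forall>h\<in>H. J_act G E \<phi> h f = f). t ^ J_deg E f)
           = (\<Prod>B\<in>sub_orbits G H E \<phi>. 1 + of_nat (card (A - {a})) * t ^ card B)"
proof -
  have "{f \<in> J_set A a E. \<forall>h\<in>H. J_act G E \<phi> h f = f}
      = {f \<in> J_set A a E. block_constant (sub_orbits G H E \<phi>) f}"
    using J_act_fixed_iff[OF assms(1)] by (auto simp: J_set_def PiE_iff)
  moreover have "finite ({a} <+> ({1::nat} \<rightarrow>\<^sub>E A - {a}))"
    using assms(3) by (intro finite_Plus finite_PiE) auto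
  ultimately show ?thesis
    using sum_power_block_constant[OF assms(2) partition_on_sub_orbits[OF assms(1)],
        of "{a} <+> ({1} \<rightarrow>\<^sub>E A - {a})" t word_deg]
    by (simp only: J_deg_def J_set_def sum_power_word_deg[OF assms(3)])
qed

text \<open>The coefficient of \<open>fps_X ^ d f\<close> at \<open>n\<close> is 1 if
  \<open>d f = n\<close> and 0 otherwise, so summing counts the elements at which the statistic
  \<open>d\<close> equals \<open>n\<close>.\<close>

lemma sum_fps_X_power:
  assumes "finite S"
  shows "(\<Sum>f\<in>S. fps_X ^ d f :: 'c :: comm_ring_1 fps) = Abs_fps (\<lambda>n. of_nat (card {f \<in> S. d f = n}))"
proof (rule fps_ext)
  fix n
  have "fps_nth (\<Sum>f\<in>S. fps_X ^ d f :: 'c fps) n = (\<Sum>f\<in>S. if d f = n then 1 else 0)"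
    by (simp add: fps_sum_nth eq_commute)
  also have "\<dots> = of_nat (card {f \<in> S. d f = n})"
    using assms by (simp flip: sum.inter_filter)
  finally show "fps_nth (\<Sum>f\<in>S. fps_X ^ d f :: 'c fps) n
      = fps_nth (Abs_fps (\<lambda>n. of_nat (card {f \<in> S. d f = n}))) n" by simp
qed

text \<open>Blocks of equal size contribute equal factors, so they are grouped by size. Index
  \<open>i\<close> stands for size \<open>Suc i\<close>, to match an infinite product that starts at
  size 1.\<close>

lemma prod_card_eq_prod_power:
  fixes F :: "nat \<Rightarrow> 'c :: comm_monoid_mult"
  assumes "finite P" and "\<And>B. B \<in> P \<Longrightarrow> 0 < card B \<and> card B \<le> N"
  shows "(\<Prod>B\<in>P. F (card B)) = (\<Prod>i<N. F (Suc i) ^ card {B \<in> P. card B = Suc i})"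
proof -
  have "(\<lambda>B. card B - 1) ` P \<subseteq> {..<N}"
    using assms(2) by fastforce
  then have "(\<Prod>B\<in>P. F (card B))
      = (\<Prod>i<N. \<Prod>B | B \<in> P \<and> card B - 1 = i. F (card B))"
    by (intro prod.group[symmetric] assms(1)) simp_all
  \<comment> \<open>Subtraction truncates at 0, so a block of size 0 would fall into the class of
    size 1; positivity of \<open>card B\<close> excludes this.\<close>
  also have "\<dots> = (\<Prod>i<N. \<Prod>B | B \<in> P \<and> card B = Suc i. F (Suc i))"
    using assms(2) by (intro prod.cong) fastforce+
  finally show ?thesis by simp
qed

theorem theorem3p15:
  fixes G :: "('g, 'm) monoid_scheme"
    and X :: "'x set"
    and \<phi> :: "'g \<Rightarrow> 'x \<Rightarrow> 'x"
    and H :: "'g set"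
    and A :: "'a set"
    and a :: 'a
  assumes "group G" and "finite (carrier G)"
    and "group_action G X \<phi>" and "finite X"
    and "subgroup H G"
    and "finite A" and "card A \<ge> 2" and "a \<in> A"
  shows "(\<lambda>i. (1 + fps_const (int (card (A - {a}))) * fps_X ^ Suc i)
              ^ num_orbits_card G H X \<phi> (Suc i))
           has_prod J_fixed_series G X \<phi> H A a
         \<and> num_fixed H (J_act G X \<phi>) (J_set A a X) = card A ^ num_orbits G H X \<phi>"
proof
  interpret group_action G X \<phi> by fact
  define P where "P = sub_orbits G H X \<phi>"
  define S where "S = {f \<in> J_set A a X. \<forall>h\<in>H. J_act G X \<phi> h f = f}"
  define c where "c = card (A - {a})"
  define F where "F k = 1 + fps_const (int c) * fps_X ^ k" for k
  have P: "partition_on X P"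
    unfolding P_def by (rule partition_on_sub_orbits) fact
  have finP: "finite P" using finite_elements[OF \<open>finite X\<close> P] .
  have cardP: "0 < card B \<and> card B \<le> card X" if "B \<in> P" for B
  proof -
    have "B \<subseteq> X" "B \<noteq> {}"
      using that partition_onD1[OF P] partition_onD3[OF P] by auto
    then show ?thesis
      using \<open>finite X\<close> by (auto simp: card_gt_0_iff intro: card_mono finite_subset)
  qed
  have finS: "finite S"
    unfolding S_def using finite_J_set[OF \<open>finite X\<close> \<open>finite A\<close>] by simp
  note gen = sum_power_J_deg_fixed[OF \<open>subgroup H G\<close> \<open>finite X\<close> \<open>finite A\<close>,
      where a = a, folded S_def P_def c_def]
  \<comment> \<open>Fixed maps of degree \<open>n\<close> are the same whether the degree or the
    invariance is imposed first.\<close>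
  have "J_fixed_series G X \<phi> H A a = Abs_fps (\<lambda>n. int (card {f \<in> S. J_deg X f = n}))"
    unfolding J_fixed_series_def num_fixed_def J_grade_def S_def
    by (intro arg_cong[of _ _ Abs_fps] ext arg_cong[of _ _ int] arg_cong[of _ _ card]) auto
  also have "\<dots> = (\<Prod>B\<in>P. F (card B))"
    using sum_fps_X_power[OF finS, of "J_deg X", where 'c = int] gen[of "fps_X :: int fps"]
    by (simp add: F_def fps_of_nat)
  also have "\<dots> = (\<Prod>i<card X. F (Suc i) ^ num_orbits_card G H X \<phi> (Suc i))"
    unfolding num_orbits_card_def P_def[symmetric]
    by (rule prod_card_eq_prod_power[OF finP cardP])
  finally have series: "J_fixed_series G X \<phi> H A a
      = (\<Prod>i<card X. F (Suc i) ^ num_orbits_card G H X \<phi> (Suc i))" .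
  \<comment> \<open>No orbit is larger than \<open>X\<close>, so all later factors are 1 and the
    infinite product converges to the finite one.\<close>
  have "num_orbits_card G H X \<phi> (Suc i) = 0" if "i \<notin> {..<card X}" for i
  proof -
    have "{B \<in> P. card B = Suc i} = {}" using that cardP by fastforce
    then show ?thesis by (simp only: num_orbits_card_def P_def[symmetric] card.empty)
  qed
  then show "(\<lambda>i. (1 + fps_const (int (card (A - {a}))) * fps_X ^ Suc i)
        ^ num_orbits_card G H X \<phi> (Suc i)) has_prod J_fixed_series G X \<phi> H A a"
    unfolding series F_def c_def by (intro has_prod_finite) simp_all
  \<comment> \<open>At \<open>t = 1\<close> the sum merely counts \<open>S\<close>, and every orbit
    contributes the factor \<open>1 + c\<close>.\<close>
  have "1 + c = card A"
    unfolding c_def using \<open>finite A\<close> \<open>a \<in> A\<close> by (metis card.remove plus_1_eq_Suc)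
  then show "num_fixed H (J_act G X \<phi>) (J_set A a X) = card A ^ num_orbits G H X \<phi>"
    using gen[of "1 :: nat"] by (simp add: num_fixed_def num_orbits_def S_def P_def)
qed

end
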